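(* Let $\bar A\in\mathbb{R}^{m\times n}$ have full column rank, $D\in\mathbb{R}^{n\times m}$, $\bar b,a\in\mathbb{R}^n$, $c\in\mathbb{R}$, and let $\mathcal{Z}\subseteq\mathbb{R}^{m\times n}$ be a convex compact set of the form $$\mathcal{Z}=\left\{\Delta\in\mathbb{R}^{m\times n}:\ \mathrm{trace}(C^{i\,T}\Delta)+q^i=0,\ i=1,\dots,I;\ \ h_\ell(\Delta)\le 0,\ \ell=1,\dots,L;\ \ g_k(\Delta)\preceq 0_{p\times p},\ k=1,\dots,K\right\}$$ (with data as described in the context) which contains $0_{m\times n}$ as a Slater point. For $\Delta\in\mathcal{Z}$ let $A(\Delta)=\bar A+\Delta$ and $b(\Delta)=\bar b+D\Delta a$. Let $\Omega>0$ be such that $\|\Delta\|_{2,2}\le\Omega$ for all $\Delta\in\mathcal{Z}$. Then: (I) $y\in\mathbb{R}^n$ satisfies $$y^TA(\Delta)^TA(\Delta)y+b(\Delta)^Ty+c\le 0\qquad\forall\Delta\in\mathcal{Z}$$ if there exists $W\in\mathbb{R}^{n\times n}$ such that $$\mathrm{trace}\big((\bar A^T\bar A+\Omega^2 I_n)W\big)+\delta^*_{\mathcal{Z}}(2\bar AW+D^Tya^T)+\bar b^Ty+c\le 0,\qquad \begin{bmatrix} W & y \\ y^T & 1 \end{bmatrix}\succeq 0_{(n+1)\times(n+1)}.$$ (II) $y\in\mathbb{R}^n$ satisfies $$\sqrt{y^TA(\Delta)^TA(\Delta)y}+b(\Delta)^Ty+c\le 0\qquad\forall\Delta\in\mathcal{Z}$$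 if there exist $W\in\mathbb{R}^{n\times n}$ and $\eta\in\mathbb{R}$ such that $$\mathrm{trace}\big((\bar A^T\bar A+\Omega^2 I_n)W\big)+\delta^*_{\mathcal{Z}}(2\bar AW+D^Tya^T)+\bar b^Ty+c+\frac{\eta}{4}\le 0,\qquad \begin{bmatrix} W & y \\ y^T & \eta \end{bmatrix}\succeq 0_{(n+1)\times(n+1)}.$$
   Context: Support function: for $\mathcal{Z}\subseteq\mathbb{R}^{m\times n}$ convex and $U\in\mathbb{R}^{m\times n}$, $\delta^*_{\mathcal{Z}}(U):=\sup_{\Delta\in\mathcal{Z}}\mathrm{trace}(\Delta U^T)$. Spectral norm: $\|\Delta\|_{2,2}=\sup_{\|x\|_2=1}\|\Delta x\|_2$. $I_n$ is the $n\times n$ identity matrix. Notation: $M\succeq N$ means that $M-N$ is symmetric and positive semi-definite; $M\succ N$ means that $M-N$ is symmetric positive definite ($\preceq,\prec$ are the reversed relations). Data of $\mathcal{Z}$: $p$ is a positive integer, $C^i\in\mathbb{R}^{m\times n}$, $q^i\in\mathbb{R}$, $h_\ell:\mathbb{R}^{m\times n}\to\mathbb{R}$ are convex continuous functions, and $g_k:\mathbb{R}^{m\times n}\to\mathbb{R}^{p\times p}$ are continuous and convex (with respect to the order $\preceq$). A Slater point is $\bar\Delta\in\mathcal{Z}$ with $h_\ell(\bar\Delta)<0$ for all $\ell$ and $g_k(\bar\Delta)\prec 0_{p\times p}$ for all $k$. *)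

theory Defs
  imports "HOL-Analysis.Analysis"
begin

text \<open>An $m \times n$ real matrix is \<open>real ^ 'n ^ 'm\<close> with \<open>m = CARD('m)\<close>, \<open>n = CARD('n)\<close>.\<close>

definition pos_semidef :: "real ^ 'n ^ 'n \<Rightarrow> bool" where
  "pos_semidef M \<longleftrightarrow> transpose M = M \<and> (\<forall>x. 0 \<le> x \<bullet> (M *v x))"

definition pos_def :: "real ^ 'n ^ 'n \<Rightarrow> bool" where
  "pos_def M \<longleftrightarrow> transpose M = M \<and> (\<forall>x. x \<noteq> 0 \<longrightarrow> 0 < x \<bullet> (M *v x))"

definition loewner_le :: "real ^ 'n ^ 'n \<Rightarrow> real ^ 'n ^ 'n \<Rightarrow> bool"  (infix \<open>\<preceq>\<close> 50) where
  "M \<preceq> N \<longleftrightarrow> pos_semidef (N - M)"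

definition loewner_less :: "real ^ 'n ^ 'n \<Rightarrow> real ^ 'n ^ 'n \<Rightarrow> bool"  (infix \<open>\<prec>\<close> 50) where
  "M \<prec> N \<longleftrightarrow> pos_def (N - M)"

definition loewner_convex :: "('a :: real_vector \<Rightarrow> real ^ 'p ^ 'p) \<Rightarrow> bool" where
  "loewner_convex g \<longleftrightarrow>
     (\<forall>X Y. \<forall>t\<in>{0..1}. g ((1 - t) *\<^sub>R X + t *\<^sub>R Y) \<preceq> (1 - t) *\<^sub>R g X + t *\<^sub>R g Y)"

text \<open>Extended-real valued, so that the supremum is meaningful for every set \<open>Z\<close>, bounded or not.\<close>

definition support_fun :: "(real ^ 'n ^ 'm) set \<Rightarrow> real ^ 'n ^ 'm \<Rightarrow> ereal" where
  "support_fun Z U = (SUP \<Delta>\<in>Z. ereal (trace (\<Delta> ** transpose U)))"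

definition outer_prod :: "real ^ 'm \<Rightarrow> real ^ 'n \<Rightarrow> real ^ 'n ^ 'm" where
  "outer_prod u v = (\<chi> i j. u $ i * v $ j)"

text \<open>The block matrix $[W, y; y^T, \eta]$; the extra row and column have index \<open>Inr ()\<close>.\<close>

definition bordered :: "real ^ 'n ^ 'n \<Rightarrow> real ^ 'n \<Rightarrow> real \<Rightarrow> real ^ ('n + unit) ^ ('n + unit)" where
  "bordered W y \<eta> = (\<chi> i j. case i of
       Inl k \<Rightarrow> (case j of Inl l \<Rightarrow> W $ k $ l | Inr _ \<Rightarrow> y $ k)
     | Inr _ \<Rightarrow> (case j of Inl l \<Rightarrow> y $ l | Inr _ \<Rightarrow> \<eta>))"

text \<open>The spectral norm of \<open>\<Delta>\<close> is \<open>onorm ((*v) \<Delta>)\<close>. The library defines \<open>onorm\<close> as a supremum of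
  quotients; it equals the supremum over unit vectors.\<close>

lemma onorm_matrix_eq_SUP_sphere:
  fixes \<Delta> :: "real ^ 'n ^ 'm"
  shows "onorm ((*v) \<Delta>) = (SUP x\<in>{x. norm x = 1}. norm (\<Delta> *v x))"
proof -
  have bl: "bounded_linear ((*v) \<Delta>)" by (rule matrix_vector_mul_bounded_linear)
  let ?S = "{x :: real ^ 'n. norm x = 1}"
  have bdd: "bdd_above ((\<lambda>x. norm (\<Delta> *v x)) ` ?S)"
  proof (rule bdd_aboveI2)
    fix x :: "real ^ 'n" assume "x \<in> ?S"
    then show "norm (\<Delta> *v x) \<le> onorm ((*v) \<Delta>)" using onorm[OF bl, of x] by simp
  qed
  have ne: "?S \<noteq> {}" using vector_choose_size[of 1] by auto
  show ?thesis
  proof (rule antisym)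
    show "(SUP x\<in>?S. norm (\<Delta> *v x)) \<le> onorm ((*v) \<Delta>)"
    proof (rule cSUP_least[OF ne])
      fix x :: "real ^ 'n" assume "x \<in> ?S"
      then show "norm (\<Delta> *v x) \<le> onorm ((*v) \<Delta>)" using onorm[OF bl, of x] by simp
    qed
    show "onorm ((*v) \<Delta>) \<le> (SUP x\<in>?S. norm (\<Delta> *v x))"
    proof (rule onorm_le)
      fix x :: "real ^ 'n"
      show "norm (\<Delta> *v x) \<le> (SUP x\<in>?S. norm (\<Delta> *v x)) * norm x"
      proof (cases "x = 0")
        case True then show ?thesis by simp
      next
        case False
        then have "sgn x \<in> ?S" by (simp add: norm_sgn)
        then have "norm (\<Delta> *v sgn x) \<le> (SUP x\<in>?S. norm (\<Delta> *v x))"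
          using bdd by (rule cSUP_upper)
        moreover have "norm (\<Delta> *v sgn x) = norm (\<Delta> *v x) / norm x"
          by (simp add: sgn_div_norm scaleR_matrix_vector_assoc[symmetric] matrix_vector_mult_scaleR
              divide_inverse mult.commute)
        ultimately show ?thesis using False by (simp add: divide_le_eq)
      qed
    qed
  qed
qed

end

theory Submission
  imports Defs
begin

text \<open>Let $u = A(\Delta)y$. Evaluating the bordered form at (row $i$ of $A(\Delta)$, $-\tau u_i$) and
  summing over $i$ gives $2\tau|u|^2 \le \mathrm{tr}(A W A^T) + \eta\tau^2|u|^2$. Take $\tau = 1$ in
  part (I), and $\tau = 1/(2|u|)$ in part (II). Expanding $A = \bar A + \Delta$, the terms linear
  in $\Delta$ are controlled by the support function, and
  $\mathrm{tr}(\Delta W \Delta^T) \le \Omega^2\,\mathrm{tr}\,W$ because the trace of a product of two positive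
  semidefinite matrices is nonnegative.\<close>

section \<open>Frobenius inner product and outer products\<close>

text \<open>The library inner product on nested vectors is the Frobenius one. Passing to it makes
  bilinearity and symmetry of the trace pairing available to the simplifier.\<close>

lemma trace_mult_transpose: "trace (X ** transpose Y) = X \<bullet> (Y :: real ^ 'n ^ 'm)"
  by (simp add: trace_def matrix_matrix_mult_def transpose_def inner_vec_def)

lemma inner_matrix_mult_left:
  fixes X Y :: "real ^ 'n ^ 'm" and W :: "real ^ 'n ^ 'n"
  shows "(X ** W) \<bullet> Y = X \<bullet> (Y ** transpose W)"
  by (simp flip: trace_mult_transpose add: matrix_transpose_mul matrix_mul_assoc)

lemma matrix_add_rdistrib: "(X + Y) ** W = X ** W + Y ** (W :: real ^ 'k ^ 'n)"
  by (simp add: vec_eq_iff matrix_matrix_mult_def sum.distrib distrib_right)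

lemma inner_outer_prod: "X \<bullet> outer_prod u v = u \<bullet> (X *v v)"
  by (simp add: inner_vec_def outer_prod_def matrix_vector_mult_def sum_distrib_left mult_ac)

text \<open>Row \<open>i\<close> of \<open>X ** W\<close> is \<open>transpose W *v X $ i\<close>,
  which is where symmetry enters. The row-wise form lets a quadratic-form inequality in
  \<open>W\<close> be summed over the rows of \<open>X\<close>.\<close>

lemma inner_matrix_mult_self:
  fixes X :: "real ^ 'n ^ 'm" and W :: "real ^ 'n ^ 'n"
  assumes "transpose W = W"
  shows "(X ** W) \<bullet> X = (\<Sum>i\<in>UNIV. X $ i \<bullet> (W *v X $ i))"
proof -
  have "(X ** W) $ i = W *v X $ i" for i
  proof -
    have "(X ** W) $ i = X $ i v* W"
      by (simp add: matrix_matrix_mult_def vector_matrix_mult_def vec_eq_iff mult.commute)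
    also have "\<dots> = transpose W *v X $ i" by simp
    finally show ?thesis by (simp only: assms)
  qed
  then show ?thesis
    by (subst inner_vec_def) (simp add: inner_commute)
qed

lemma inner_gram: "y \<bullet> ((transpose X ** X) *v y) = (norm (X *v (y :: real ^ 'n)))\<^sup>2"
  for X :: "real ^ 'n ^ 'm"
  by (metis dot_lmul_matrix matrix_vector_mul_assoc power2_norm_eq_inner transpose_matrix_vector
      inner_commute)

section \<open>Positive semidefinite matrices: Cauchy-Schwarz and the trace pairing\<close>

text \<open>The form at \<open>x + t *\<^sub>R z\<close> is a quadratic in \<open>t\<close> that is
  never negative, so its discriminant is at most zero.\<close>

lemma pos_semidef_sq_le:
  assumes "pos_semidef W"
  shows "(x \<bullet> (W *v z))\<^sup>2 \<le> (x \<bullet> (W *v x)) * (z \<bullet> (W *v z))"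
proof -
  define p q r where "p = z \<bullet> (W *v z)" and "q = x \<bullet> (W *v z)" and "r = x \<bullet> (W *v x)"
  have sym: "z \<bullet> (W *v x) = q"
    using assms unfolding pos_semidef_def q_def
    by (metis dot_lmul_matrix inner_commute transpose_matrix_vector)
  have nonneg: "0 \<le> r + 2 * t * q + t\<^sup>2 * p" for t
  proof -
    have "0 \<le> (x + t *\<^sub>R z) \<bullet> (W *v (x + t *\<^sub>R z))"
      using assms by (simp add: pos_semidef_def)
    also have "\<dots> = r + 2 * t * q + t\<^sup>2 * p"
      by (simp add: matrix_vector_right_distrib matrix_vector_mult_scaleR inner_add_left inner_add_right
          sym p_def r_def flip: q_def) (simp add: q_def algebra_simps power2_eq_square)
    finally show ?thesis .
  qed
  have p0: "0 \<le> p" using assms by (simp add: pos_semidef_def p_def)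
  have "q\<^sup>2 \<le> r * p"
  proof (cases "p = 0")
    case True
    have "q = 0"
    proof (rule ccontr)
      assume "q \<noteq> 0"
      \<comment> \<open>With \<open>p = 0\<close> the quadratic is affine in \<open>t\<close>, and
        this \<open>t\<close> gives it the value -1.\<close>
      then show False
        using nonneg[of "- (r + 1) / (2 * q)"] True by (simp add: field_simps)
    qed
    then show ?thesis using True by simp
  next
    case False
    \<comment> \<open>\<open>- q / p\<close> minimises the quadratic; the minimum is
      \<open>r - q\<^sup>2 / p\<close>.\<close>
    then show ?thesis
      using nonneg[of "- q / p"] p0 by (simp add: field_simps power2_eq_square)
  qed
  then show ?thesis by (simp add: p_def q_def r_def)
qed

lemma outer_prod_mult_vec: "outer_prod u v *v x = (v \<bullet> x) *\<^sub>R u"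
  by (simp add: vec_eq_iff outer_prod_def matrix_vector_mult_def inner_vec_def sum_distrib_left mult_ac)

lemma trace_mult_outer_prod: "trace (M ** outer_prod u v) = v \<bullet> (M *v u)"
  by (simp add: trace_def matrix_matrix_mult_def outer_prod_def inner_vec_def
      matrix_vector_mult_def sum_distrib_left mult_ac)

lemma trace_scaleR: "trace (r *\<^sub>R (M :: real ^ 'n ^ 'n)) = r * trace M"
  by (simp add: trace_def sum_distrib_left)

text \<open>Symmetric Gaussian elimination: each step splits off a rank-one matrix and clears one
  row and column of \<open>W\<close>.\<close>

lemma trace_pos_semidef_mult_nonneg_on:
  fixes W M :: "real ^ 'n ^ 'n"
  assumes "finite S" "pos_semidef W" "pos_semidef M" "\<And>i j. i \<notin> S \<Longrightarrow> W $ i $ j = 0"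
  shows "0 \<le> trace (M ** W)"
  using assms(1,2,4)
proof (induction S arbitrary: W rule: finite_induct)
  case empty
  then have "W = 0" by (simp add: vec_eq_iff)
  then show ?case by (simp add: trace_def matrix_matrix_mult_def)
next
  case (insert k S)
  define w where "w = W *v axis k 1"
  define d where "d = W $ k $ k"
  have w: "w $ i = W $ i $ k" for i
    by (simp add: w_def matrix_vector_mul_component inner_axis)
  have sym: "W $ i $ j = W $ j $ i" for i j
    using insert.prems(1) by (simp add: pos_semidef_def transpose_def vec_eq_iff)
  have d: "axis k 1 \<bullet> w = d"
    by (simp add: inner_axis' d_def w)
  \<comment> \<open>Used twice: for \<open>d = 0\<close> it forces column \<open>k\<close> to vanish
    (take \<open>x = w\<close>), and for \<open>d > 0\<close> it says that the remainder
    \<open>V\<close> is again positive semidefinite.\<close>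
  have CS: "(x \<bullet> w)\<^sup>2 \<le> (x \<bullet> (W *v x)) * d" for x
    using pos_semidef_sq_le[OF insert.prems(1), of x "axis k 1"] by (simp add: d flip: w_def)
  have d0: "0 \<le> d"
    using insert.prems(1) unfolding pos_semidef_def d[symmetric] w_def by blast
  show ?case
  proof (cases "d = 0")
    case True
    then have "w = 0" using CS[of w] by simp
    then have "W $ k $ j = 0" for j
      using w[of j] sym[of k j] by simp
    then show ?thesis
      using insert.prems by (intro insert.IH) (metis insert_iff)+
  next
    case False
    then have dpos: "0 < d" using d0 by simp
    \<comment> \<open>The Schur complement of the pivot \<open>d\<close>, padded with zeros in row
      and column \<open>k\<close>.\<close>
    define V where "V = W - (1 / d) *\<^sub>R outer_prod w w"
    have V: "V $ i $ j = W $ i $ j - w $ i * w $ j / d" for i j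
      by (simp add: V_def outer_prod_def)
    have "0 \<le> x \<bullet> (V *v x)" for x
    proof -
      have "x \<bullet> (V *v x) = x \<bullet> (W *v x) - (x \<bullet> w)\<^sup>2 / d"
        by (simp add: V_def matrix_vector_mult_diff_rdistrib inner_diff_right
            scaleR_matrix_vector_assoc[symmetric] outer_prod_mult_vec power2_eq_square inner_commute)
      then show ?thesis using CS[of x] dpos by (simp add: pos_divide_le_eq)
    qed
    moreover have "transpose V = V"
      using sym by (simp add: vec_eq_iff transpose_def V mult.commute)
    ultimately have "pos_semidef V" by (simp add: pos_semidef_def)
    \<comment> \<open>In row \<open>k\<close> the correction \<open>w $ k * w $ j / d\<close> equals
      \<open>w $ j\<close>, hence cancels \<open>W $ k $ j\<close>; in the other rows outside
      \<open>S\<close> both \<open>W $ i $ j\<close> and \<open>w $ i\<close> are zero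
      already.\<close>
    moreover have "V $ i $ j = 0" if "i \<notin> S" for i j
    proof (cases "i = k")
      case True
      then show ?thesis using False sym[of j k] by (simp add: V w flip: d_def)
    next
      case False
      then show ?thesis using that insert.prems(2) by (simp add: V w)
    qed
    ultimately have "0 \<le> trace (M ** V)" by (rule insert.IH)
    moreover have "0 \<le> w \<bullet> (M *v w)" using assms(3) by (simp add: pos_semidef_def)
    moreover have "trace (M ** W) = trace (M ** V) + (w \<bullet> (M *v w)) / d"
    proof -
      have "M ** W = M ** V + (1 / d) *\<^sub>R (M ** outer_prod w w)"
        by (simp add: V_def scalar_matrix_assoc flip: matrix_scalar_ac matrix_add_ldistrib)
      then show ?thesis
        by (simp add: trace_add trace_scaleR trace_mult_outer_prod)
    qed
    ultimately show ?thesis using dpos by simp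
  qed
qed

lemma trace_pos_semidef_mult_nonneg:
  fixes M W :: "real ^ 'n ^ 'n"
  assumes "pos_semidef M" "pos_semidef W"
  shows "0 \<le> trace (M ** W)"
  using trace_pos_semidef_mult_nonneg_on[of UNIV W M] assms by simp

section \<open>Gram matrices and the spectral-norm bound\<close>

lemma trace_gram_add_scaled_mult:
  fixes X :: "real ^ 'n ^ 'm" and W :: "real ^ 'n ^ 'n"
  shows "trace ((transpose X ** X + r *\<^sub>R mat 1) ** W) = (X ** W) \<bullet> X + r * trace W"
proof -
  have "(transpose X ** X + r *\<^sub>R mat 1) ** W = transpose X ** (X ** W) + r *\<^sub>R W"
    by (simp add: matrix_add_rdistrib matrix_mul_assoc scalar_matrix_assoc[symmetric])
  then show ?thesis
    by (simp add: trace_add trace_scaleR trace_mul_sym[of "transpose X"] trace_mult_transpose)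
qed

text \<open>The norm bound makes \<open>r\<^sup>2 *\<^sub>R mat 1 - transpose X ** X\<close>
  positive semidefinite, and its trace pairing with \<open>W\<close> is therefore
  nonnegative.\<close>

lemma inner_matrix_mult_self_le_onorm:
  fixes X :: "real ^ 'n ^ 'm" and W :: "real ^ 'n ^ 'n"
  assumes "pos_semidef W" "onorm ((*v) X) \<le> r"
  shows "(X ** W) \<bullet> X \<le> r\<^sup>2 * trace W"
proof -
  define M where "M = r\<^sup>2 *\<^sub>R mat 1 - transpose X ** X"
  have "pos_semidef M"
    unfolding pos_semidef_def
  proof (intro conjI allI)
    show "transpose M = M"
      by (simp add: M_def vec_eq_iff transpose_def matrix_matrix_mult_def mat_def mult.commute)
    fix x :: "real ^ 'n"
    have "norm (X *v x) \<le> r * norm x"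
      using onorm[OF matrix_vector_mul_bounded_linear, of X x] assms(2)
      by (meson mult_right_mono norm_ge_zero order_trans)
    then have "(norm (X *v x))\<^sup>2 \<le> r\<^sup>2 * (norm x)\<^sup>2"
      by (metis norm_ge_zero power_mono power_mult_distrib)
    then show "0 \<le> x \<bullet> (M *v x)"
      by (simp add: M_def matrix_vector_mult_diff_rdistrib inner_diff_right inner_gram
          scaleR_matrix_vector_assoc[symmetric] power2_norm_eq_inner)
  qed
  then have "0 \<le> trace (M ** W)" using assms(1) by (rule trace_pos_semidef_mult_nonneg)
  \<comment> \<open>The summand \<open>0 *\<^sub>R mat 1\<close> presents the Gram matrix as the
    case \<open>r = 0\<close> of \<open>trace_gram_add_scaled_mult\<close>.\<close>
  moreover have "M ** W + (transpose X ** X + 0 *\<^sub>R mat 1) ** W = r\<^sup>2 *\<^sub>R W"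
    by (simp add: M_def scalar_matrix_assoc[symmetric] flip: matrix_add_rdistrib)
  then have "trace (M ** W) + (X ** W) \<bullet> X = r\<^sup>2 * trace W"
    using trace_gram_add_scaled_mult[of X 0 W]
    by (metis add.right_neutral mult_zero_left trace_add trace_scaleR)
  ultimately show ?thesis by simp
qed

section \<open>The bordered matrix as a quadratic form\<close>

lemma bordered_form:
  fixes W :: "real ^ 'n ^ 'n"
  assumes "0 \<preceq> bordered W y \<eta>"
  shows "0 \<le> x \<bullet> (W *v x) + 2 * t * (x \<bullet> y) + \<eta> * t\<^sup>2"
proof -
  define v :: "real ^ ('n + unit)"
    where "v = (\<chi> i. case i of Inl k \<Rightarrow> x $ k | Inr _ \<Rightarrow> t)"
  have sum_split: "(\<Sum>i\<in>UNIV. f i) = (\<Sum>k\<in>UNIV. f (Inl k)) + f (Inr ())"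
    for f :: "'n + unit \<Rightarrow> real"
    by (simp add: UNIV_sum sum.union_disjoint sum.reindex UNIV_unit image_iff disjoint_iff)
  have "0 \<le> v \<bullet> (bordered W y \<eta> *v v)"
    using assms by (simp add: loewner_le_def pos_semidef_def)
  also have "\<dots> = x \<bullet> (W *v x) + 2 * t * (x \<bullet> y) + \<eta> * t\<^sup>2"
    by (simp add: inner_vec_def matrix_vector_mult_def sum_split v_def bordered_def
        algebra_simps sum.distrib sum_distrib_left power2_eq_square)
  finally show ?thesis .
qed

text \<open>Symmetry of \<open>W\<close> is inherited from the whole block matrix, and nonnegativity
  is the bordered form at \<open>t = 0\<close>.\<close>

lemma bordered_pos_semidef:
  assumes "0 \<preceq> bordered W y \<eta>"
  shows "pos_semidef W"
proof -
  have "bordered W y \<eta> $ Inl i $ Inl j = bordered W y \<eta> $ Inl j $ Inl i" for i j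
    using assms by (simp add: loewner_le_def pos_semidef_def transpose_def vec_eq_iff)
  then have "transpose W = W"
    by (simp add: bordered_def transpose_def vec_eq_iff)
  then show ?thesis
    using bordered_form[OF assms, of _ 0] by (simp add: pos_semidef_def)
qed

lemma bordered_gram_bound:
  fixes X :: "real ^ 'n ^ 'm" and W :: "real ^ 'n ^ 'n"
  assumes "0 \<preceq> bordered W y \<eta>"
  shows "2 * \<tau> * (norm (X *v y))\<^sup>2 \<le> (X ** W) \<bullet> X + \<eta> * \<tau>\<^sup>2 * (norm (X *v y))\<^sup>2"
proof -
  let ?u = "X *v y"
  \<comment> \<open>Since \<open>X $ i \<bullet> y\<close> is \<open>?u $ i\<close>, the choice
    \<open>t = - \<tau> * ?u $ i\<close> turns every cross term into a multiple of a square with the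
    sign of \<open>- \<tau>\<close>.\<close>
  have "0 \<le> (\<Sum>i\<in>UNIV. X $ i \<bullet> (W *v X $ i) + 2 * (- \<tau> * ?u $ i) * (X $ i \<bullet> y)
      + \<eta> * (- \<tau> * ?u $ i)\<^sup>2)"
    by (intro sum_nonneg bordered_form[OF assms])
  also have "\<dots> = (\<Sum>i\<in>UNIV. X $ i \<bullet> (W *v X $ i)) - 2 * \<tau> * (?u \<bullet> ?u) + \<eta> * \<tau>\<^sup>2 * (?u \<bullet> ?u)"
    by (simp add: inner_vec_def[of ?u] matrix_vector_mul_component sum.distrib sum_negf sum_subtractf
        sum_distrib_left power_mult_distrib power2_eq_square algebra_simps)
  finally show ?thesis
    using bordered_pos_semidef[OF assms]
    by (simp add: inner_matrix_mult_self pos_semidef_def power2_norm_eq_inner)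
qed

section \<open>The bound for a single perturbation\<close>

text \<open>Symmetry of \<open>W\<close> merges the two cross terms into the linear one. The term
  quadratic in \<open>E\<close> is replaced by \<open>r\<^sup>2 * trace W\<close>, which the trace
  on the right absorbs.\<close>

lemma perturbed_gram_le:
  fixes X E :: "real ^ 'n ^ 'm" and W :: "real ^ 'n ^ 'n"
  assumes "pos_semidef W" "onorm ((*v) E) \<le> r"
  shows "((X + E) ** W) \<bullet> (X + E)
      \<le> trace ((transpose X ** X + r\<^sup>2 *\<^sub>R mat 1) ** W) + E \<bullet> (2 *\<^sub>R (X ** W))"
proof -
  have "(E ** W) \<bullet> X = E \<bullet> (X ** W)"
    using assms(1) inner_matrix_mult_left[of E W X] by (simp add: pos_semidef_def)
  then show ?thesis
    using inner_matrix_mult_self_le_onorm[OF assms] unfolding trace_gram_add_scaled_mult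
    by (simp add: matrix_add_rdistrib inner_add_left inner_add_right
        inner_commute[of E])
qed

lemma support_fun_upper: "\<Delta> \<in> Z \<Longrightarrow> ereal (\<Delta> \<bullet> U) \<le> support_fun Z U"
  unfolding support_fun_def trace_mult_transpose by (rule SUP_upper)

text \<open>Serves both parts: the slack \<open>e\<close> is 0 in (I) and \<open>\<eta> / 4\<close>
  in (II).\<close>

lemma robust_certificate_bound:
  fixes X \<Delta> :: "real ^ 'n ^ 'm" and D :: "real ^ 'm ^ 'n" and W :: "real ^ 'n ^ 'n"
  assumes cert: "ereal (trace ((transpose X ** X + r\<^sup>2 *\<^sub>R mat 1) ** W))
        + support_fun Z (2 *\<^sub>R (X ** W) + outer_prod (transpose D *v y) a)
        + ereal (bbar \<bullet> y) + ereal c + ereal e \<le> 0"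
    and "pos_semidef W" "\<Delta> \<in> Z" "onorm ((*v) \<Delta>) \<le> r"
  shows "((X + \<Delta>) ** W) \<bullet> (X + \<Delta>) + (bbar + (D ** \<Delta>) *v a) \<bullet> y + c + e \<le> 0"
proof -
  let ?T = "trace ((transpose X ** X + r\<^sup>2 *\<^sub>R mat 1) ** W)"
  let ?U = "2 *\<^sub>R (X ** W) + outer_prod (transpose D *v y) a"
  \<comment> \<open>Replacing the supremum by its value at \<open>\<Delta>\<close> leaves only
    finite summands, so the inequality descends to the reals.\<close>
  have "ereal ?T + ereal (\<Delta> \<bullet> ?U) + ereal (bbar \<bullet> y) + ereal c + ereal e
      \<le> ereal ?T + support_fun Z ?U + ereal (bbar \<bullet> y) + ereal c + ereal e"
    by (intro add_mono order_refl support_fun_upper assms(3))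
  then have "ereal (?T + \<Delta> \<bullet> ?U + bbar \<bullet> y + c + e) \<le> 0"
    using cert by (simp only: plus_ereal.simps order_trans)
  then have "?T + \<Delta> \<bullet> ?U + bbar \<bullet> y + c + e \<le> 0" by simp
  moreover have "\<Delta> \<bullet> outer_prod (transpose D *v y) a = ((D ** \<Delta>) *v a) \<bullet> y"
    by (simp add: inner_outer_prod dot_lmul_matrix inner_commute[of "(D ** \<Delta>) *v a"]
        matrix_vector_mul_assoc)
  ultimately show ?thesis
    using perturbed_gram_le[OF assms(2,4), of X]
    by (simp add: inner_add_left inner_add_right)
qed

section \<open>Certificates for the quadratic and the conic quadratic constraint\<close>

theorem theorem2:
  fixes Abar :: "real ^ 'n ^ 'm"
    and D :: "real ^ 'm ^ 'n"
    and bbar a :: "real ^ 'n"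
    and c \<Omega> :: real
    and Z :: "(real ^ 'n ^ 'm) set"
    and I L K :: nat
    and C :: "nat \<Rightarrow> real ^ 'n ^ 'm"
    and q :: "nat \<Rightarrow> real"
    and h :: "nat \<Rightarrow> real ^ 'n ^ 'm \<Rightarrow> real"
    and g :: "nat \<Rightarrow> real ^ 'n ^ 'm \<Rightarrow> real ^ 'p ^ 'p"
    and A :: "real ^ 'n ^ 'm \<Rightarrow> real ^ 'n ^ 'm"
    and b :: "real ^ 'n ^ 'm \<Rightarrow> real ^ 'n"
  assumes full_col_rank: "rank Abar = CARD('n)"
    and h_convex: "\<And>l. l \<in> {1..L} \<Longrightarrow> convex_on UNIV (h l)"
    and h_cont: "\<And>l. l \<in> {1..L} \<Longrightarrow> continuous_on UNIV (h l)"
    and g_convex: "\<And>k. k \<in> {1..K} \<Longrightarrow> loewner_convex (g k)"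
    and g_cont: "\<And>k. k \<in> {1..K} \<Longrightarrow> continuous_on UNIV (g k)"
    and Z_eq: "Z = {\<Delta>. (\<forall>i\<in>{1..I}. trace (transpose (C i) ** \<Delta>) + q i = 0)
                      \<and> (\<forall>l\<in>{1..L}. h l \<Delta> \<le> 0)
                      \<and> (\<forall>k\<in>{1..K}. g k \<Delta> \<preceq> 0)}"
    and Z_convex: "convex Z"
    and Z_compact: "compact Z"
    and slater_mem: "0 \<in> Z"
    and slater_h: "\<And>l. l \<in> {1..L} \<Longrightarrow> h l 0 < 0"
    and slater_g: "\<And>k. k \<in> {1..K} \<Longrightarrow> g k 0 \<prec> 0"
    and A_eq: "\<And>\<Delta>. \<Delta> \<in> Z \<Longrightarrow> A \<Delta> = Abar + \<Delta>"
    and b_eq: "\<And>\<Delta>. \<Delta> \<in> Z \<Longrightarrow> b \<Delta> = bbar + (D ** \<Delta>) *v a"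
    and Omega_pos: "\<Omega> > 0"
    and Omega_bound: "\<And>\<Delta>. \<Delta> \<in> Z \<Longrightarrow> onorm ((*v) \<Delta>) \<le> \<Omega>"
  shows
    "(\<forall>y. (\<exists>W. ereal (trace ((transpose Abar ** Abar + \<Omega>\<^sup>2 *\<^sub>R mat 1) ** W))
                 + support_fun Z (2 *\<^sub>R (Abar ** W) + outer_prod (transpose D *v y) a)
                 + ereal (bbar \<bullet> y) + ereal c \<le> 0
               \<and> 0 \<preceq> bordered W y 1)
         \<longrightarrow> (\<forall>\<Delta>\<in>Z. y \<bullet> ((transpose (A \<Delta>) ** A \<Delta>) *v y) + b \<Delta> \<bullet> y + c \<le> 0))
     \<and>
     (\<forall>y. (\<exists>W \<eta>. ereal (trace ((transpose Abar ** Abar + \<Omega>\<^sup>2 *\<^sub>R mat 1) ** W))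
                 + support_fun Z (2 *\<^sub>R (Abar ** W) + outer_prod (transpose D *v y) a)
                 + ereal (bbar \<bullet> y) + ereal c + ereal (\<eta> / 4) \<le> 0
               \<and> 0 \<preceq> bordered W y \<eta>)
         \<longrightarrow> (\<forall>\<Delta>\<in>Z. sqrt (y \<bullet> ((transpose (A \<Delta>) ** A \<Delta>) *v y)) + b \<Delta> \<bullet> y + c \<le> 0))"
proof (intro conjI allI impI ballI; elim exE conjE)
  fix y W \<Delta>
  assume cert: "ereal (trace ((transpose Abar ** Abar + \<Omega>\<^sup>2 *\<^sub>R mat 1) ** W))
        + support_fun Z (2 *\<^sub>R (Abar ** W) + outer_prod (transpose D *v y) a)
        + ereal (bbar \<bullet> y) + ereal c \<le> 0"
    and psd: "0 \<preceq> bordered W y 1" and \<Delta>: "\<Delta> \<in> Z"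
  have "(norm ((Abar + \<Delta>) *v y))\<^sup>2 \<le> ((Abar + \<Delta>) ** W) \<bullet> (Abar + \<Delta>)"
    using bordered_gram_bound[OF psd, of 1 "Abar + \<Delta>"] by simp
  moreover have "((Abar + \<Delta>) ** W) \<bullet> (Abar + \<Delta>) + (bbar + (D ** \<Delta>) *v a) \<bullet> y + c + 0 \<le> 0"
    using cert by (intro robust_certificate_bound[OF _ bordered_pos_semidef[OF psd] \<Delta> Omega_bound[OF \<Delta>]])
      (simp add: zero_ereal_def[symmetric])
  ultimately show "y \<bullet> ((transpose (A \<Delta>) ** A \<Delta>) *v y) + b \<Delta> \<bullet> y + c \<le> 0"
    by (simp add: A_eq[OF \<Delta>] b_eq[OF \<Delta>] inner_gram)
next
  fix y W \<eta> \<Delta>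
  assume cert: "ereal (trace ((transpose Abar ** Abar + \<Omega>\<^sup>2 *\<^sub>R mat 1) ** W))
        + support_fun Z (2 *\<^sub>R (Abar ** W) + outer_prod (transpose D *v y) a)
        + ereal (bbar \<bullet> y) + ereal c + ereal (\<eta> / 4) \<le> 0"
    and psd: "0 \<preceq> bordered W y \<eta>" and \<Delta>: "\<Delta> \<in> Z"
  let ?u = "(Abar + \<Delta>) *v y" and ?S = "((Abar + \<Delta>) ** W) \<bullet> (Abar + \<Delta>)"
  have "norm ?u \<le> ?S + \<eta> / 4"
  proof (cases "?u = 0")
    case True
    \<comment> \<open>\<open>\<tau> = 1 / (2 * norm ?u)\<close> is no use for \<open>?u = 0\<close>.
      Here the corner entry gives \<open>0 \<le> \<eta>\<close>, and \<open>\<tau> = 0\<close> gives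
      \<open>0 \<le> ?S\<close>.\<close>
    have "0 \<le> \<eta>" using bordered_form[OF psd, of 0 1] by simp
    moreover have "0 \<le> ?S" using bordered_gram_bound[OF psd, of 0 "Abar + \<Delta>"] by simp
    ultimately show ?thesis using True by simp
  next
    case False
    \<comment> \<open>This \<open>\<tau>\<close> makes the left side \<open>norm ?u\<close> and the
      last term \<open>\<eta> / 4\<close>.\<close>
    then show ?thesis
      using bordered_gram_bound[OF psd, of "1 / (2 * norm ?u)" "Abar + \<Delta>"]
      by (simp add: power2_eq_square)
  qed
  moreover have "?S + (bbar + (D ** \<Delta>) *v a) \<bullet> y + c + \<eta> / 4 \<le> 0"
    by (rule robust_certificate_bound[OF cert bordered_pos_semidef[OF psd] \<Delta> Omega_bound[OF \<Delta>]])
  ultimately show "sqrt (y \<bullet> ((transpose (A \<Delta>) ** A \<Delta>) *v y)) + b \<Delta> \<bullet> y + c \<le> 0"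
    by (simp add: A_eq[OF \<Delta>] b_eq[OF \<Delta>] inner_gram)
qed

end
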